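(* Let $Q=\sum_{i=1}^NQ_i\in\mathbb{R}^{4(N+1)\times4(N+1)}$ be the data matrix specified in the context. The following semidefinite program (call it (R)) $$\begin{aligned}\min_{Z\succeq0}\ &\operatorname{tr}(QZ)\\ \text{subject to}\ &\operatorname{tr}([Z]_{qq})=1,\\ &[Z]_{q_iq_i}=[Z]_{qq},\quad i=1,\dots,N,\\ &[Z]_{qq_i}=[Z]_{qq_i}^{\mathsf T},\quad i=1,\dots,N,\\ &[Z]_{q_iq_j}=[Z]_{q_iq_j}^{\mathsf T},\quad 1\le i<j\le N,\end{aligned}$$ is a convex relaxation of the non-convex program $$\min_{Z\succeq0}\ \operatorname{tr}(QZ)\quad\text{subject to}\quad \operatorname{tr}([Z]_{qq})=1,\ \ [Z]_{q_iq_i}=[Z]_{qq}\ (i=1,\dots,N),\ \ \operatorname{rank}(Z)=1.$$ Moreover, (R) is always tighter than the naive relaxation $$\min_{Z\succeq0}\ \operatorname{tr}(QZ)\quad\text{subject to}\quad \operatorname{tr}([Z]_{qq})=1,\ \ [Z]_{q_iq_i}=[Z]_{qq}\ (i=1,\dots,N),$$ that is, the optimal objective of (R) is always closer to the optimal objective of the Quadratically-Constrained Quadratic Program $$\min_{x\in\mathbb{R}^{4(N+1)}}\ \sum_{i=1}^Nx^{\mathsf T}Q_ix\quad\text{subject to}\quad x_q^{\mathsf T}x_q=1,\ \ x_{q_i}x_{q_i}^{\mathsf T}=x_qx_q^{\mathsf T}\ (i=1,\dots,N),$$ when compared to the naive relaxation.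
   Context: Data: $a_i,b_i\in\mathbb{R}^3$, $\sigma_i>0$ ($i=1,\dots,N$) and a constant $\bar c^2$. For $a\in\mathbb{R}^3$, $\hat a=[a^{\mathsf T}\ 0]^{\mathsf T}\in\mathbb{R}^4$. For $p=[p_1\ p_2\ p_3\ p_4]^{\mathsf T}\in\mathbb{R}^4$, $$\Omega_1(p)=\begin{bmatrix} p_4&-p_3&p_2&p_1\\ p_3&p_4&-p_1&p_2\\ -p_2&p_1&p_4&p_3\\ -p_1&-p_2&-p_3&p_4\end{bmatrix},\qquad \Omega_2(p)=\begin{bmatrix} p_4&p_3&-p_2&p_1\\ -p_3&p_4&p_1&p_2\\ p_2&-p_1&p_4&p_3\\ -p_1&-p_2&-p_3&p_4\end{bmatrix}.$$ Vectors $x=[q^{\mathsf T}\ q_1^{\mathsf T}\cdots q_N^{\mathsf T}]^{\mathsf T}\in\mathbb{R}^{4(N+1)}$ are partitioned into 4-dimensional subvectors $x_q,x_{q_1},\dots,x_{q_N}$, and matrices in $\mathbb{R}^{4(N+1)\times4(N+1)}$ into $4\times4$ blocks $[Z]_{uv}$ indexed by $u,v\in\{q,q_1,\dots,q_N\}$. $Q_i$ is the symmetric matrix with $[Q_i]_{q_iq_i}=Q_{ii}$, $[Q_i]_{qq_i}=[Q_i]_{q_iq}=Q_{0i}$, and all other blocks zero, where $$Q_{ii}=\frac{(\|b_i\|^2+\|a_i\|^2)I_4+2\Omega_1(\hat b_i)\Omega_2(\hat a_i)}{2\sigma_i^2}+\frac{\bar c^2}{2}I_4,\qquad Q_{0i}=\frac{(\|b_i\|^2+\|a_i\|^2)I_4+2\Omega_1(\hat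 b_i)\Omega_2(\hat a_i)}{4\sigma_i^2}-\frac{\bar c^2}{4}I_4 ,$$ and $I_4$ is the $4\times4$ identity matrix. $Z\succeq0$ means $Z$ is symmetric positive semidefinite. A convex relaxation of a minimization problem is a convex minimization problem with the same objective whose feasible set contains that of the original problem. *)

theory Defs
  imports "HOL-Analysis.Analysis"
begin

record 'a min_problem =
  objective :: "'a \<Rightarrow> real"
  feasible :: "'a set"

definition is_optimal_value :: "'a min_problem \<Rightarrow> real \<Rightarrow> bool" where
  "is_optimal_value P v \<longleftrightarrow>
     (\<exists>x. is_arg_min (objective P) (\<lambda>y. y \<in> feasible P) x \<and> objective P x = v)"

text \<open>The library predicate \<open>convex_on S f\<close> includes convexity of the set \<open>S\<close>.\<close>

definition convex_problem :: "'a::real_vector min_problem \<Rightarrow> bool" where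
  "convex_problem P \<longleftrightarrow> convex_on (feasible P) (objective P)"

definition convex_relaxation :: "'a::real_vector min_problem \<Rightarrow> 'a min_problem \<Rightarrow> bool" where
  "convex_relaxation R P \<longleftrightarrow>
     convex_problem R \<and> objective R = objective P \<and> feasible P \<subseteq> feasible R"

text \<open>
  The \<open>N\<close> measurements are indexed by a finite linearly ordered type \<open>'n\<close>, so \<open>N = CARD('n)\<close>.
  The block labels \<open>q, q\<^sub>1, \<dots>, q\<^sub>N\<close> are the elements of \<open>'n option\<close>: \<open>None\<close> is \<open>q\<close> and
  \<open>Some i\<close> is \<open>q\<^sub>i\<close>. A coordinate of a vector of dimension \<open>4(N+1)\<close> is a block label together with
  a position inside that block.
\<close>

type_synonym 'n bvec = "real^('n option \<times> 4)"
type_synonym 'n bmat = "real^('n option \<times> 4)^('n option \<times> 4)"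

definition subvec :: "'n::finite bvec \<Rightarrow> 'n option \<Rightarrow> real^4" where
  "subvec x u = (\<chi> k. x $ (u, k))"

definition block :: "'n::finite bmat \<Rightarrow> 'n option \<Rightarrow> 'n option \<Rightarrow> real^4^4" where
  "block Z u v = (\<chi> k l. Z $ (u, k) $ (v, l))"

definition of_blocks :: "('n option \<Rightarrow> 'n option \<Rightarrow> real^4^4) \<Rightarrow> 'n::finite bmat" where
  "of_blocks B = (\<chi> r s. B (fst r) (fst s) $ snd r $ snd s)"

definition outer :: "real^'m \<Rightarrow> real^'m \<Rightarrow> real^'m^'m" where
  "outer x y = (\<chi> k l. x $ k * y $ l)"

definition psd :: "real^'m^'m \<Rightarrow> bool" where
  "psd Z \<longleftrightarrow> transpose Z = Z \<and> (\<forall>x. 0 \<le> x \<bullet> (Z *v x))"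

definition hat :: "real^3 \<Rightarrow> real^4" where
  "hat a = vector [a$1, a$2, a$3, 0]"

definition \<Omega>1 :: "real^4 \<Rightarrow> real^4^4" where
  "\<Omega>1 p = vector
     [vector [  p$4, - p$3,   p$2, p$1],
      vector [  p$3,   p$4, - p$1, p$2],
      vector [- p$2,   p$1,   p$4, p$3],
      vector [- p$1, - p$2, - p$3, p$4]]"

definition \<Omega>2 :: "real^4 \<Rightarrow> real^4^4" where
  "\<Omega>2 p = vector
     [vector [  p$4,   p$3, - p$2, p$1],
      vector [- p$3,   p$4,   p$1, p$2],
      vector [  p$2, - p$1,   p$4, p$3],
      vector [- p$1, - p$2, - p$3, p$4]]"

definition residual_mat :: "real^3 \<Rightarrow> real^3 \<Rightarrow> real^4^4" where
  "residual_mat a b = ((norm b)\<^sup>2 + (norm a)\<^sup>2) *\<^sub>R mat 1 + 2 *\<^sub>R (\<Omega>1 (hat b) ** \<Omega>2 (hat a))"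

definition Q_diag :: "real^3 \<Rightarrow> real^3 \<Rightarrow> real \<Rightarrow> real \<Rightarrow> real^4^4" where
  "Q_diag a b \<sigma> cbar =
     (1 / (2 * \<sigma>\<^sup>2)) *\<^sub>R residual_mat a b + (cbar\<^sup>2 / 2) *\<^sub>R mat 1"

definition Q_off :: "real^3 \<Rightarrow> real^3 \<Rightarrow> real \<Rightarrow> real \<Rightarrow> real^4^4" where
  "Q_off a b \<sigma> cbar =
     (1 / (4 * \<sigma>\<^sup>2)) *\<^sub>R residual_mat a b - (cbar\<^sup>2 / 4) *\<^sub>R mat 1"

definition Q_meas ::
  "('n \<Rightarrow> real^3) \<Rightarrow> ('n \<Rightarrow> real^3) \<Rightarrow> ('n \<Rightarrow> real) \<Rightarrow> real \<Rightarrow> 'n::finite \<Rightarrow> 'n bmat" where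
  "Q_meas a b \<sigma> cbar i = of_blocks (\<lambda>u v.
     if u = Some i \<and> v = Some i then Q_diag (a i) (b i) (\<sigma> i) cbar
     else if (u = None \<and> v = Some i) \<or> (u = Some i \<and> v = None) then Q_off (a i) (b i) (\<sigma> i) cbar
     else 0)"

definition Q_data ::
  "('n \<Rightarrow> real^3) \<Rightarrow> ('n \<Rightarrow> real^3) \<Rightarrow> ('n::finite \<Rightarrow> real) \<Rightarrow> real \<Rightarrow> 'n bmat" where
  "Q_data a b \<sigma> cbar = (\<Sum>i\<in>UNIV. Q_meas a b \<sigma> cbar i)"

definition qcqp ::
  "('n \<Rightarrow> real^3) \<Rightarrow> ('n \<Rightarrow> real^3) \<Rightarrow> ('n::finite \<Rightarrow> real) \<Rightarrow> real \<Rightarrow> 'n bvec min_problem" where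
  "qcqp a b \<sigma> cbar = \<lparr>
     objective = (\<lambda>x. \<Sum>i\<in>UNIV. x \<bullet> (Q_meas a b \<sigma> cbar i *v x)),
     feasible = {x. subvec x None \<bullet> subvec x None = 1 \<and>
       (\<forall>i. outer (subvec x (Some i)) (subvec x (Some i)) =
            outer (subvec x None) (subvec x None))}\<rparr>"

definition sdp_rank1 ::
  "('n \<Rightarrow> real^3) \<Rightarrow> ('n \<Rightarrow> real^3) \<Rightarrow> ('n::finite \<Rightarrow> real) \<Rightarrow> real \<Rightarrow> 'n bmat min_problem" where
  "sdp_rank1 a b \<sigma> cbar = \<lparr>
     objective = (\<lambda>Z. trace (Q_data a b \<sigma> cbar ** Z)),
     feasible = {Z. psd Z \<and> trace (block Z None None) = 1 \<and>
       (\<forall>i. block Z (Some i) (Some i) = block Z None None) \<and>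
       rank Z = 1}\<rparr>"

definition sdp_naive ::
  "('n \<Rightarrow> real^3) \<Rightarrow> ('n \<Rightarrow> real^3) \<Rightarrow> ('n::finite \<Rightarrow> real) \<Rightarrow> real \<Rightarrow> 'n bmat min_problem" where
  "sdp_naive a b \<sigma> cbar = \<lparr>
     objective = (\<lambda>Z. trace (Q_data a b \<sigma> cbar ** Z)),
     feasible = {Z. psd Z \<and> trace (block Z None None) = 1 \<and>
       (\<forall>i. block Z (Some i) (Some i) = block Z None None)}\<rparr>"

definition sdp_R ::
  "('n \<Rightarrow> real^3) \<Rightarrow> ('n \<Rightarrow> real^3) \<Rightarrow> ('n::{finite,linorder} \<Rightarrow> real) \<Rightarrow> real \<Rightarrow>
     'n bmat min_problem" where
  "sdp_R a b \<sigma> cbar = \<lparr>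
     objective = (\<lambda>Z. trace (Q_data a b \<sigma> cbar ** Z)),
     feasible = {Z. psd Z \<and> trace (block Z None None) = 1 \<and>
       (\<forall>i. block Z (Some i) (Some i) = block Z None None) \<and>
       (\<forall>i. block Z None (Some i) = transpose (block Z None (Some i))) \<and>
       (\<forall>i j. i < j \<longrightarrow> block Z (Some i) (Some j) = transpose (block Z (Some i) (Some j)))}\<rparr>"

end

theory Submission
  imports Defs
begin

text \<open>
  A feasible matrix of rank one is a multiple of \<open>y y\<^sup>T\<close>, and the equality of its diagonal blocks
  forces the subvectors of \<open>y\<close> to agree up to sign. Hence all its blocks are symmetric, and the
  symmetry constraints of (R) are redundant for the rank-one program. Every QCQP point \<open>x\<close> lifts
  to the feasible point \<open>x x\<^sup>T\<close> of (R) with the same objective, so the three optimal values form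
  a chain naive \<open>\<le>\<close> (R) \<open>\<le>\<close> QCQP. The optima are attained because every feasible set is compact:
  the entries of a positive semidefinite matrix are bounded by its diagonal.
\<close>

section \<open>Attained minima and their comparison\<close>

lemma is_optimal_value_exists:
  fixes P :: "'a::topological_space min_problem"
  assumes "compact (feasible P)" "feasible P \<noteq> {}" "continuous_on (feasible P) (objective P)"
  shows "\<exists>v. is_optimal_value P v"
proof -
  obtain x where "x \<in> feasible P" "\<forall>y\<in>feasible P. objective P x \<le> objective P y"
    using continuous_attains_inf[OF assms] by blast
  then have "is_arg_min (objective P) (\<lambda>y. y \<in> feasible P) x"
    by (auto simp: is_arg_min_linorder)
  then show ?thesis
    unfolding is_optimal_value_def by blast
qed

text \<open>A minimizer of \<open>P\<close> is matched by a point of \<open>R\<close> with the same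
  value, and \<open>w\<close> lies below that value. \<open>P\<close> and \<open>R\<close> may have
  variables of different types, as needed to compare a vector program with a matrix program.\<close>

lemma is_optimal_value_mono:
  assumes "is_optimal_value P v" "is_optimal_value R w"
    and "\<And>x. x \<in> feasible P \<Longrightarrow> \<exists>y\<in>feasible R. objective R y = objective P x"
  shows "w \<le> v"
  using assms unfolding is_optimal_value_def is_arg_min_linorder by metis

section \<open>Subvectors, blocks and outer products\<close>

lemma outer_nth [simp]: "outer x y $ i $ j = x $ i * y $ j"
  by (simp add: outer_def)

lemma subvec_nth [simp]: "subvec x u $ k = x $ (u, k)"
  by (simp add: subvec_def)

lemma block_nth [simp]: "block Z u v $ k $ l = Z $ (u, k) $ (v, l)"
  by (simp add: block_def)

lemma outer_mult_vector: "outer x y *v z = (y \<bullet> z) *\<^sub>R x"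
  by (simp add: vec_eq_iff matrix_vector_mult_def inner_vec_def sum_distrib_left mult_ac)

lemma psd_outer: "psd (outer x x)"
  by (simp add: psd_def outer_mult_vector inner_commute vec_eq_iff transpose_def mult.commute)

lemma trace_outer: "trace (outer x y) = x \<bullet> y"
  by (simp add: trace_def inner_vec_def)

lemma trace_matrix_mul_outer: "trace (A ** outer x x) = x \<bullet> (A *v x)"
  by (simp add: trace_def matrix_matrix_mult_def matrix_vector_mult_def inner_vec_def
      sum_distrib_left mult_ac)

lemma block_outer: "block (outer x y) u v = outer (subvec x u) (subvec y v)"
  by (simp add: vec_eq_iff)

lemma sum_matrix_vector_mult: "sum A I *v x = (\<Sum>i\<in>I. A i *v (x :: real^'m))"
  by (induction I rule: infinite_finite_induct) (auto simp: matrix_vector_mult_add_rdistrib)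

text \<open>At a coordinate \<open>k\<close> with \<open>y $ k \<noteq> 0\<close> the squares agree,
  which fixes a sign; the products with coordinate \<open>k\<close> then carry this one sign to all
  other coordinates.\<close>

lemma outer_self_eqD:
  assumes "outer x x = outer y y"
  shows "x = y \<or> x = - y"
proof -
  have prods: "x $ i * x $ j = y $ i * y $ j" for i j
    using assms by (metis outer_nth)
  show ?thesis
  proof (cases "y = 0")
    case True
    then have "x $ i = 0" for i
      using prods[of i i] by simp
    with True show ?thesis
      by (simp add: vec_eq_iff)
  next
    case False
    then obtain k where k: "y $ k \<noteq> 0"
      by (auto simp: vec_eq_iff)
    have "x $ k = y $ k \<or> x $ k = - y $ k"
      using prods[of k k] by (simp add: square_eq_iff)
    then show ?thesis
    proof
      assume xk: "x $ k = y $ k"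
      then have "x $ i = y $ i" for i
        using prods[of i k] k by simp
      then show ?thesis by (simp add: vec_eq_iff)
    next
      assume xk: "x $ k = - y $ k"
      have "x $ i = - y $ i" for i
      proof -
        have "(x $ i + y $ i) * y $ k = 0"
          using prods[of i k] xk by (simp add: distrib_right)
        with k show ?thesis
          by simp
      qed
      then show ?thesis by (simp add: vec_eq_iff)
    qed
  qed
qed

text \<open>All rows are multiples of a single vector \<open>w\<close>, so every 2 by 2 minor
  vanishes.\<close>

lemma rank_1_minors:
  fixes A :: "real^'n^'m"
  assumes "rank A = 1"
  shows "A $ i $ j * A $ k $ l = A $ i $ l * A $ k $ j"
proof -
  have "dim (rows A) = 1"
    using assms by (simp add: row_rank_def)
  then obtain B where B: "rows A \<subseteq> span B" "card B = 1"
    by (metis basis_exists)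
  then obtain w where "B = {w}"
    by (metis card_1_singletonE)
  then have "\<exists>c. row r A = c *\<^sub>R w" for r
    using B by (auto simp: rows_def span_singleton)
  then obtain c where "row r A = c r *\<^sub>R w" for r
    by metis
  then have "A $ r = c r *\<^sub>R w" for r
    by (simp add: row_def)
  then show ?thesis
    by simp
qed

section \<open>Positive semidefinite matrices and linear objectives\<close>

lemma psd_symmetric: "psd Z \<Longrightarrow> Z $ r $ s = Z $ s $ r"
  by (drule conjunct1[OF iffD1[OF psd_def]]) (simp add: vec_eq_iff transpose_def)

lemma quadratic_form_axis:
  fixes Z :: "real^'m^'m"
  shows "(axis r \<alpha> + axis s \<beta>) \<bullet> (Z *v (axis r \<alpha> + axis s \<beta>)) =
    \<alpha>\<^sup>2 * Z $ r $ r + \<alpha> * \<beta> * (Z $ r $ s + Z $ s $ r) + \<beta>\<^sup>2 * Z $ s $ s"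
proof -
  have "(Z *v axis j c) $ i = c * Z $ i $ j" for i j c
    by (simp add: matrix_vector_mult_def axis_def if_distrib mult.commute cong: if_cong)
  then show ?thesis
    by (simp add: inner_axis' algebra_simps
        power2_eq_square)
qed

lemma psd_diag_nonneg:
  assumes "psd Z"
  shows "0 \<le> Z $ r $ r"
proof -
  have "0 \<le> (axis r 1 + axis r 0) \<bullet> (Z *v (axis r 1 + axis r 0))"
    using assms unfolding psd_def by blast
  then show ?thesis
    unfolding quadratic_form_axis by simp
qed

text \<open>Testing the quadratic form on the sum and on the difference of two unit vectors bounds
  the entry from both sides.\<close>

lemma psd_entry_le:
  assumes "psd Z"
  shows "2 * \<bar>Z $ r $ s\<bar> \<le> Z $ r $ r + Z $ s $ s"
proof -
  have "0 \<le> (axis r 1 + axis s 1) \<bullet> (Z *v (axis r 1 + axis s 1))"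
    "0 \<le> (axis r 1 + axis s (-1)) \<bullet> (Z *v (axis r 1 + axis s (-1)))"
    using assms unfolding psd_def by blast+
  then show ?thesis
    unfolding quadratic_form_axis using psd_symmetric[OF assms, of r s] by simp
qed

lemma bounded_entries_matrix:
  fixes S :: "(real^'n^'m) set"
  assumes "\<And>Z r s. Z \<in> S \<Longrightarrow> \<bar>Z $ r $ s\<bar> \<le> C"
  shows "bounded S"
proof -
  have "norm Z \<le> (\<Sum>r::'m\<in>UNIV. \<Sum>s::'n\<in>UNIV. C)" if "Z \<in> S" for Z
  proof -
    have "norm Z \<le> (\<Sum>r\<in>UNIV. norm (Z $ r))"
      unfolding norm_vec_def by (rule L2_set_le_sum) simp
    also have "\<dots> \<le> (\<Sum>r::'m\<in>UNIV. \<Sum>s::'n\<in>UNIV. C)"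
      by (intro sum_mono order.trans[OF norm_le_l1_cart] assms that)
    finally show ?thesis .
  qed
  then show ?thesis
    unfolding bounded_iff by blast
qed

lemma psd_add:
  assumes "psd X" "psd Y"
  shows "psd (X + Y)"
  using assms unfolding psd_def
  by (simp add: vec_eq_iff transpose_def matrix_vector_mult_add_rdistrib inner_add_right)

lemma psd_scaleR:
  assumes "psd X" "0 \<le> c"
  shows "psd (c *\<^sub>R X)"
  using assms unfolding psd_def
  by (simp add: vec_eq_iff transpose_def scaleR_matrix_vector_assoc[symmetric])

lemma convex_psd: "convex {Z. psd Z}"
  by (auto simp: convex_def intro: psd_add psd_scaleR)

text \<open>Each pair of entries and each test vector contributes one closed condition on
  \<open>Z\<close>, and the set is their intersection.\<close>

lemma closed_psd: "closed {Z::real^'m^'m. psd Z}"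
proof -
  have "{Z::real^'m^'m. psd Z} =
    (\<Inter>r s. {Z. Z $ s $ r = Z $ r $ s}) \<inter> (\<Inter>x. {Z. 0 \<le> x \<bullet> (Z *v x)})"
    by (auto simp: psd_def vec_eq_iff transpose_def)
  also have "closed \<dots>"
    unfolding inner_vec_def matrix_vector_mult_def
    by (intro closed_Int closed_INT ballI closed_Collect_eq closed_Collect_le)
      (simp_all add: continuous_intros)
  finally show ?thesis .
qed

text \<open>Linearity serves twice: for convexity of the objective and for its continuity.\<close>

lemma linear_trace_matrix_mul: "linear (\<lambda>Z::real^'m^'m. trace (A ** Z))"
  by (rule linearI)
    (simp_all add: trace_def matrix_matrix_mult_def sum.distrib sum_distrib_left algebra_simps)

lemma convex_on_linear:
  fixes f :: "'a::real_vector \<Rightarrow> real"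
  assumes "linear f" "convex S"
  shows "convex_on S f"
  using assms by (auto simp: convex_on_def linear_add linear_scale)

section \<open>Feasible sets of the naive relaxation and of the QCQP\<close>

context
  fixes a b :: "'n::finite \<Rightarrow> real^3" and \<sigma> :: "'n \<Rightarrow> real" and cbar :: real
begin

lemma feasible_naive_diag:
  assumes "Z \<in> feasible (sdp_naive a b \<sigma> cbar)"
  shows "block Z u u = block Z None None"
  using assms by (cases u) (auto simp: sdp_naive_def)

text \<open>Every diagonal entry of \<open>Z\<close> appears on the diagonal of the common block,
  where the entries are nonnegative with sum 1; \<open>psd_entry_le\<close> passes the bound on to
  the other entries.\<close>

lemma feasible_naive_entry_le:
  assumes "Z \<in> feasible (sdp_naive a b \<sigma> cbar)"
  shows "\<bar>Z $ r $ s\<bar> \<le> 1"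
proof -
  have psd: "psd Z" and tr: "trace (block Z None None) = 1"
    using assms by (auto simp: sdp_naive_def)
  have diag: "Z $ r $ r \<le> 1" for r
  proof -
    obtain u k where r: "r = (u, k)"
      by fastforce
    have "Z $ r $ r = block Z None None $ k $ k"
      using arg_cong[OF feasible_naive_diag[OF assms, of u], of "\<lambda>M. M $ k $ k"] r by simp
    also have "\<dots> \<le> trace (block Z None None)"
      unfolding trace_def by (rule member_le_sum) (auto intro: psd_diag_nonneg[OF psd])
    finally show ?thesis
      using tr by simp
  qed
  show ?thesis
    using psd_entry_le[OF psd, of r s] diag[of r] diag[of s] by linarith
qed

lemma compact_feasible_naive: "compact (feasible (sdp_naive a b \<sigma> cbar))"
proof -
  have "feasible (sdp_naive a b \<sigma> cbar) = {Z. psd Z} \<inter> {Z. trace (block Z None None) = 1} \<inter>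
    (\<Inter>i. {Z. block Z (Some i) (Some i) = block Z None None})"
    by (auto simp: sdp_naive_def)
  also have "closed \<dots>"
    unfolding trace_def block_def
    by (intro closed_Int closed_psd closed_INT ballI closed_Collect_eq)
      (simp_all add: continuous_intros)
  finally show ?thesis
    using feasible_naive_entry_le bounded_entries_matrix compact_eq_bounded_closed by blast
qed

lemma feasible_rank1_block_symmetric:
  assumes "Z \<in> feasible (sdp_naive a b \<sigma> cbar)" "rank Z = 1"
  shows "transpose (block Z u v) = block Z u v"
proof -
  have psd: "psd Z" and tr: "trace (block Z None None) = 1"
    using assms by (auto simp: sdp_naive_def)
  have "\<exists>k. Z $ (None, k) $ (None, k) \<noteq> 0"
  proof (rule ccontr)
    assume "\<not> ?thesis"
    then have "trace (block Z None None) = 0"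
      by (simp add: trace_def)
    with tr show False
      by simp
  qed
  then obtain k where k: "Z $ (None, k) $ (None, k) \<noteq> 0" (is "?d \<noteq> 0")
    by blast
  \<comment> \<open>The row through the nonzero pivot \<open>?d\<close> serves as the rank-one
    factor. Carrying \<open>?d\<close> along avoids normalizing by its square root.\<close>
  define y where "y = Z $ (None, k)"
  have Z: "?d * Z $ r $ s = y $ r * y $ s" for r s
    using rank_1_minors[OF assms(2), of "(None, k)" "(None, k)" r s] psd_symmetric[OF psd, of r]
    by (simp add: y_def)
  have blockZ: "?d *\<^sub>R block Z u v = outer (subvec y u) (subvec y v)" for u v
    by (simp add: vec_eq_iff Z)
  \<comment> \<open>Equal diagonal blocks of \<open>Z\<close> give equal outer squares of the
    subvectors of \<open>y\<close>.\<close>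
  have sign: "subvec y u = subvec y None \<or> subvec y u = - subvec y None" for u
    by (rule outer_self_eqD) (metis blockZ feasible_naive_diag[OF assms(1)])
  have "transpose (outer (subvec y u) (subvec y v)) = outer (subvec y u) (subvec y v)"
    using sign[of u] sign[of v]
    by (auto simp: vec_eq_iff transpose_def mult.commute simp del: subvec_nth)
  then have "?d *\<^sub>R transpose (block Z u v) = ?d *\<^sub>R block Z u v"
    unfolding blockZ[symmetric] by (simp add: vec_eq_iff transpose_def)
  with k show ?thesis
    by simp
qed

lemma compact_feasible_qcqp: "compact (feasible (qcqp a b \<sigma> cbar))"
proof -
  have "feasible (qcqp a b \<sigma> cbar) = {x. subvec x None \<bullet> subvec x None = 1} \<inter>
    (\<Inter>i. {x. outer (subvec x (Some i)) (subvec x (Some i)) =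
      outer (subvec x None) (subvec x None)})"
    by (auto simp: qcqp_def)
  also have "closed \<dots>"
    unfolding subvec_def outer_def
    by (intro closed_Int closed_INT ballI closed_Collect_eq) (simp_all add: continuous_intros)
  finally have closed: "closed (feasible (qcqp a b \<sigma> cbar))" .
  have "norm x \<le> (\<Sum>r::'n option \<times> 4\<in>UNIV. 1)" if x: "x \<in> feasible (qcqp a b \<sigma> cbar)" for x
  proof -
    have "\<bar>x $ r\<bar> \<le> 1" for r
    proof -
      obtain u k where r: "r = (u, k)"
        by fastforce
      have "outer (subvec x u) (subvec x u) = outer (subvec x None) (subvec x None)"
        using x by (cases u) (auto simp: qcqp_def)
      \<comment> \<open>Taking traces turns equal outer squares into equal squared norms.\<close>
      then have "subvec x u \<bullet> subvec x u = 1"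
        using x by (metis (mono_tags, lifting) trace_outer qcqp_def min_problem.select_convs(2)
            mem_Collect_eq)
      then have "norm (subvec x u) = 1"
        by (simp add: norm_eq_1)
      then show ?thesis
        using component_le_norm_cart[of "subvec x u" k] r by simp
    qed
    then show ?thesis
      by (intro order.trans[OF norm_le_l1_cart] sum_mono)
  qed
  then have "bounded (feasible (qcqp a b \<sigma> cbar))"
    unfolding bounded_iff by blast
  with closed show ?thesis
    by (simp add: compact_eq_bounded_closed)
qed

lemma feasible_qcqp_nonempty: "feasible (qcqp a b \<sigma> cbar) \<noteq> {}"
proof -
  \<comment> \<open>All subvectors are the same unit vector, so both QCQP constraints hold at
    once.\<close>
  define x :: "'n bvec" where "x = (\<chi> r. if snd r = 1 then 1 else 0)"
  have "subvec x u = axis 1 1" for u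
    by (simp add: vec_eq_iff x_def axis_def)
  then have "x \<in> feasible (qcqp a b \<sigma> cbar)"
    by (simp add: qcqp_def inner_axis_axis)
  then show ?thesis
    by blast
qed

end

section \<open>The semidefinite program (R)\<close>

context
  fixes a b :: "'n::{finite,linorder} \<Rightarrow> real^3" and \<sigma> :: "'n \<Rightarrow> real" and cbar :: real
begin

lemma feasible_R_eq:
  "feasible (sdp_R a b \<sigma> cbar) = feasible (sdp_naive a b \<sigma> cbar) \<inter>
    {Z. \<forall>i. block Z None (Some i) = transpose (block Z None (Some i))} \<inter>
    {Z. \<forall>i j. i < j \<longrightarrow> block Z (Some i) (Some j) = transpose (block Z (Some i) (Some j))}"
  by (auto simp: sdp_R_def sdp_naive_def)

text \<open>The symmetry constraints cut a closed subset out of a compact set; the premise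
  \<open>i < j\<close> does not depend on \<open>Z\<close>, so the implication keeps the condition
  closed.\<close>

lemma compact_feasible_R: "compact (feasible (sdp_R a b \<sigma> cbar))"
  unfolding feasible_R_eq transpose_def block_def
  by (intro compact_Int_closed compact_feasible_naive closed_Collect_all closed_Collect_imp
      closed_Collect_eq open_Collect_const) (simp_all add: continuous_intros)

text \<open>Positive semidefinite matrices form a convex cone and all other constraints are affine
  in \<open>Z\<close>.\<close>

lemma convex_feasible_R: "convex (feasible (sdp_R a b \<sigma> cbar))"
proof (rule convexI)
  fix X Y :: "'n bmat" and s t :: real
  assume X: "X \<in> feasible (sdp_R a b \<sigma> cbar)" and Y: "Y \<in> feasible (sdp_R a b \<sigma> cbar)"
    and st: "0 \<le> s" "0 \<le> t" "s + t = 1"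
  have block: "block (s *\<^sub>R X + t *\<^sub>R Y) u v = s *\<^sub>R block X u v + t *\<^sub>R block Y u v" for u v
    by (simp add: vec_eq_iff)
  have trace: "trace (s *\<^sub>R A + t *\<^sub>R B) = s * trace A + t * trace B" for A B :: "real^4^4"
    by (simp add: trace_def sum.distrib sum_distrib_left)
  have transpose: "transpose (s *\<^sub>R A + t *\<^sub>R B) = s *\<^sub>R transpose A + t *\<^sub>R transpose B"
    for A B :: "real^4^4"
    by (simp add: vec_eq_iff transpose_def)
  show "s *\<^sub>R X + t *\<^sub>R Y \<in> feasible (sdp_R a b \<sigma> cbar)"
    using X Y st by (simp add: sdp_R_def block trace transpose psd_add psd_scaleR)
qed

text \<open>The subvectors of \<open>x\<close> agree up to sign, so each block of
  \<open>outer x x\<close> is plus or minus one symmetric matrix.\<close>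

lemma outer_feasible_R:
  assumes "x \<in> feasible (qcqp a b \<sigma> cbar)"
  shows "outer x x \<in> feasible (sdp_R a b \<sigma> cbar)"
proof -
  have diag: "outer (subvec x (Some i)) (subvec x (Some i)) =
      outer (subvec x None) (subvec x None)" for i
    using assms by (auto simp: qcqp_def)
  have sign: "subvec x u = subvec x None \<or> subvec x u = - subvec x None" for u
    by (cases u) (use outer_self_eqD[OF diag] in auto)
  have "transpose (outer (subvec x u) (subvec x v)) = outer (subvec x u) (subvec x v)" for u v
    using sign[of u] sign[of v]
    by (auto simp: vec_eq_iff transpose_def mult.commute simp del: subvec_nth)
  with assms show ?thesis
    by (simp add: sdp_R_def qcqp_def psd_outer block_outer trace_outer)
qed

lemma objective_outer:
  "objective (sdp_R a b \<sigma> cbar) (outer x x) = objective (qcqp a b \<sigma> cbar) x"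
  by (simp add: sdp_R_def qcqp_def Q_data_def trace_matrix_mul_outer sum_matrix_vector_mult
      inner_sum_right)

lemma convex_relaxation_R: "convex_relaxation (sdp_R a b \<sigma> cbar) (sdp_rank1 a b \<sigma> cbar)"
proof -
  have "Z \<in> feasible (sdp_R a b \<sigma> cbar)" if Z: "Z \<in> feasible (sdp_rank1 a b \<sigma> cbar)" for Z
  proof -
    have naive: "Z \<in> feasible (sdp_naive a b \<sigma> cbar)" and "rank Z = 1"
      using Z by (auto simp: sdp_rank1_def sdp_naive_def)
    then show ?thesis
      using feasible_rank1_block_symmetric[OF naive] by (simp add: feasible_R_eq)
  qed
  moreover have "convex_on (feasible (sdp_R a b \<sigma> cbar)) (objective (sdp_R a b \<sigma> cbar))"
    by (intro convex_on_linear convex_feasible_R) (simp add: sdp_R_def linear_trace_matrix_mul)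
  ultimately show ?thesis
    by (auto simp: convex_relaxation_def convex_problem_def sdp_R_def sdp_rank1_def)
qed

end

theorem proposition8:
  fixes a b :: "'n::{finite,linorder} \<Rightarrow> real^3"
    and \<sigma> :: "'n \<Rightarrow> real"
    and cbar :: real
  assumes "\<And>i. \<sigma> i > 0"
  shows "convex_relaxation (sdp_R a b \<sigma> cbar) (sdp_rank1 a b \<sigma> cbar) \<and>
    (\<exists>v_qcqp v_R v_naive.
       is_optimal_value (qcqp a b \<sigma> cbar) v_qcqp \<and>
       is_optimal_value (sdp_R a b \<sigma> cbar) v_R \<and>
       is_optimal_value (sdp_naive a b \<sigma> cbar) v_naive \<and>
       \<bar>v_R - v_qcqp\<bar> \<le> \<bar>v_naive - v_qcqp\<bar>)"
proof -
  have sub: "feasible (sdp_R a b \<sigma> cbar) \<subseteq> feasible (sdp_naive a b \<sigma> cbar)"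
    unfolding feasible_R_eq by blast
  have R_nonempty: "feasible (sdp_R a b \<sigma> cbar) \<noteq> {}"
    using feasible_qcqp_nonempty outer_feasible_R by blast
  \<comment> \<open>An arbitrary \<open>S\<close> lets this serve both (R) and the naive relaxation,
    which share the objective.\<close>
  have cont: "continuous_on S (\<lambda>Z. trace (Q_data a b \<sigma> cbar ** Z))" for S
    by (simp add: linear_continuous_on linear_conv_bounded_linear[symmetric]
        linear_trace_matrix_mul)
  have "\<exists>v. is_optimal_value (qcqp a b \<sigma> cbar) v"
  proof (intro is_optimal_value_exists compact_feasible_qcqp feasible_qcqp_nonempty)
    show "continuous_on (feasible (qcqp a b \<sigma> cbar)) (objective (qcqp a b \<sigma> cbar))"
      by (simp add: qcqp_def inner_vec_def matrix_vector_mult_def continuous_intros)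
  qed
  then obtain v_qcqp where q: "is_optimal_value (qcqp a b \<sigma> cbar) v_qcqp" ..
  have "\<exists>v. is_optimal_value (sdp_R a b \<sigma> cbar) v"
    by (intro is_optimal_value_exists compact_feasible_R R_nonempty) (simp add: sdp_R_def cont)
  then obtain v_R where R: "is_optimal_value (sdp_R a b \<sigma> cbar) v_R" ..
  have "\<exists>v. is_optimal_value (sdp_naive a b \<sigma> cbar) v"
    using sub R_nonempty
    by (intro is_optimal_value_exists compact_feasible_naive) (auto simp: sdp_naive_def cont)
  then obtain v_naive where n: "is_optimal_value (sdp_naive a b \<sigma> cbar) v_naive" ..
  have "v_naive \<le> v_R"
  proof (rule is_optimal_value_mono[OF R n])
    fix Z assume "Z \<in> feasible (sdp_R a b \<sigma> cbar)"
    moreover have "objective (sdp_naive a b \<sigma> cbar) Z = objective (sdp_R a b \<sigma> cbar) Z"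
      by (simp add: sdp_naive_def sdp_R_def)
    ultimately show "\<exists>Y\<in>feasible (sdp_naive a b \<sigma> cbar).
        objective (sdp_naive a b \<sigma> cbar) Y = objective (sdp_R a b \<sigma> cbar) Z"
      using sub by blast
  qed
  moreover have "v_R \<le> v_qcqp"
    by (rule is_optimal_value_mono[OF q R]) (blast intro: outer_feasible_R objective_outer)
  \<comment> \<open>Both relaxation values lie below \<open>v_qcqp\<close>, so the larger one is at
    least as close to it.\<close>
  ultimately have "\<bar>v_R - v_qcqp\<bar> \<le> \<bar>v_naive - v_qcqp\<bar>"
    by linarith
  with convex_relaxation_R q R n show ?thesis
    by blast
qed

end
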